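(* Let $d\ge1$ and let $\Phi=\{\phi_i\}_{i=1}^\ell$ be an iterated function system on $\mathbb{R}^d$ of the form $$\phi_i(x)=\frac{x}{m_i}+a_i,\qquad i=1,\ldots,\ell,$$ where $m_i\in\mathbb{Z}$ with $|m_i|>1$ and $a_i\in\mathbb{Q}^d$. Then $\Phi$ satisfies the asymptotically weak separation condition (AWSC).
   Context: An iterated function system (IFS) of similarities on $\mathbb{R}^d$ is a finite collection $\Phi=\{\phi_i\}_{i=1}^\ell$ of contracting similarities; $r_i\in(0,1)$ denotes the contraction ratio of $\phi_i$ (for the maps $x\mapsto x/m_i+a_i$ it is $1/|m_i|$). Its attractor $K$ is the unique non-empty compact set with $K=\bigcup_{i=1}^\ell\phi_i(K)$. For a word $u=u_1\ldots u_k\in\{1,\ldots,\ell\}^k$ write $\phi_u=\phi_{u_1}\circ\cdots\circ\phi_{u_k}$. AWSC: for $n\in\mathbb{N}$ let $$W_n=\{u_1\ldots u_k\in\{1,\ldots,\ell\}^k: k\ge1,\ r_{u_1}\cdots r_{u_k}\le 2^{-n}<r_{u_1}\cdots r_{u_{k-1}}\}$$ (an empty product being $1$), and $$t_n=\sup_{x\in\mathbb{R}^d}\#\{\phi_u: u\in W_n,\ \phi_u(K)\cap B(x,2^{-n})\ne\emptyset\},$$ where $B(x,r)$ is the closed ball and $\#$ counts distinct maps. $\Phi$ satisfies the asymptotically weak separation condition if $\lim_{n\to\infty}\frac1n\log t_n=0$. *)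

theory Defs
  imports "HOL-Analysis.Analysis"
begin

definition similarity_with_ratio :: "real \<Rightarrow> (real ^ 'd \<Rightarrow> real ^ 'd) \<Rightarrow> bool" where
  "similarity_with_ratio r f \<longleftrightarrow> (\<forall>x y. dist (f x) (f y) = r * dist x y)"

definition contracting_similarity :: "(real ^ 'd \<Rightarrow> real ^ 'd) \<Rightarrow> bool" where
  "contracting_similarity f \<longleftrightarrow> (\<exists>r. 0 < r \<and> r < 1 \<and> similarity_with_ratio r f)"

(* The ratio is unique because real ^ 'd has at least two points. *)
definition contraction_ratio :: "(real ^ 'd \<Rightarrow> real ^ 'd) \<Rightarrow> real" where
  "contraction_ratio f = (THE r. similarity_with_ratio r f)"

(* A system is a family indexed by {1..l}; repetitions are allowed, and the values of phi
   outside {1..l} are irrelevant. *)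
definition ifs :: "nat \<Rightarrow> (nat \<Rightarrow> real ^ 'd \<Rightarrow> real ^ 'd) \<Rightarrow> bool" where
  "ifs l phi \<longleftrightarrow> 1 \<le> l \<and> (\<forall>i\<in>{1..l}. contracting_similarity (phi i))"

(* Exists and is unique for every ifs, by Hutchinson's theorem. *)
definition attractor :: "nat \<Rightarrow> (nat \<Rightarrow> real ^ 'd \<Rightarrow> real ^ 'd) \<Rightarrow> (real ^ 'd) set" where
  "attractor l phi = (THE K. K \<noteq> {} \<and> compact K \<and> K = (\<Union>i\<in>{1..l}. phi i ` K))"

definition word_map :: "(nat \<Rightarrow> real ^ 'd \<Rightarrow> real ^ 'd) \<Rightarrow> nat list \<Rightarrow> real ^ 'd \<Rightarrow> real ^ 'd" where
  "word_map phi u = foldr (\<circ>) (map phi u) id"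

definition word_ratio :: "(nat \<Rightarrow> real ^ 'd \<Rightarrow> real ^ 'd) \<Rightarrow> nat list \<Rightarrow> real" where
  "word_ratio phi u = prod_list (map (\<lambda>i. contraction_ratio (phi i)) u)"

definition level_words :: "nat \<Rightarrow> (nat \<Rightarrow> real ^ 'd \<Rightarrow> real ^ 'd) \<Rightarrow> nat \<Rightarrow> nat list set" where
  "level_words l phi n =
     {u. u \<noteq> [] \<and> set u \<subseteq> {1..l} \<and>
         word_ratio phi u \<le> (1/2) ^ n \<and> (1/2) ^ n < word_ratio phi (butlast u)}"

definition maps_near ::
  "nat \<Rightarrow> (nat \<Rightarrow> real ^ 'd \<Rightarrow> real ^ 'd) \<Rightarrow> nat \<Rightarrow> real ^ 'd \<Rightarrow> (real ^ 'd \<Rightarrow> real ^ 'd) set" where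
  "maps_near l phi n x =
     {word_map phi u | u. u \<in> level_words l phi n \<and>
        word_map phi u ` attractor l phi \<inter> cball x ((1/2) ^ n) \<noteq> {}}"

(* For an ifs, level_words is finite (lemma finite_level_words), so the cardinalities are those of
   finite sets and the supremum is that of a bounded set of naturals. *)
definition overlap_count :: "nat \<Rightarrow> (nat \<Rightarrow> real ^ 'd \<Rightarrow> real ^ 'd) \<Rightarrow> nat \<Rightarrow> nat" where
  "overlap_count l phi n = (SUP x. card (maps_near l phi n x))"

(* overlap_count is positive for n \<ge> 1; level_words is empty for n = 0, which does not affect
   the limit. *)
definition awsc :: "nat \<Rightarrow> (nat \<Rightarrow> real ^ 'd \<Rightarrow> real ^ 'd) \<Rightarrow> bool" where
  "awsc l phi \<longleftrightarrow> (\<lambda>n. ln (real (overlap_count l phi n)) / real n) \<longlonglongrightarrow> 0"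

lemma contraction_ratio_eq:
  fixes f :: "real ^ 'd \<Rightarrow> real ^ 'd"
  assumes "similarity_with_ratio r f"
  shows "contraction_ratio f = r"
  unfolding contraction_ratio_def
proof (rule the_equality)
  show "similarity_with_ratio r f" by fact
next
  fix s assume "similarity_with_ratio s f"
  with assms have "s * dist (0 :: real ^ 'd) 1 = r * dist (0 :: real ^ 'd) 1"
    unfolding similarity_with_ratio_def by metis
  moreover have "(0 :: real ^ 'd) \<noteq> 1"
    by simp
  ultimately show "s = r" by simp
qed

lemma contraction_ratio_homothety:
  fixes a :: "real ^ 'd"
  shows "contraction_ratio (\<lambda>x. (1 / c) *\<^sub>R x + a) = 1 / \<bar>c\<bar>"
proof (rule contraction_ratio_eq)
  have "dist ((1 / c) *\<^sub>R x + a) ((1 / c) *\<^sub>R y + a) = 1 / \<bar>c\<bar> * dist x y" for x y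
    by (simp add: dist_norm flip: scaleR_diff_right)
  then show "similarity_with_ratio (1 / \<bar>c\<bar>) (\<lambda>x. (1 / c) *\<^sub>R x + a)"
    by (simp add: similarity_with_ratio_def)
qed

lemma finite_level_words:
  fixes phi :: "nat \<Rightarrow> real ^ 'd \<Rightarrow> real ^ 'd"
  assumes "ifs l phi"
  shows "finite (level_words l phi n)"
proof -
  define r where "r i = contraction_ratio (phi i)" for i
  have r: "0 < r i \<and> r i < 1" if "i \<in> {1..l}" for i
    using assms that contraction_ratio_eq
    unfolding ifs_def contracting_similarity_def r_def by metis
  define c where "c = Max (r ` {1..l})"
  have ne: "r ` {1..l} \<noteq> {}" using assms by (auto simp: ifs_def)
  have "c \<in> r ` {1..l}" unfolding c_def using ne by (intro Max_in) auto
  with r have c: "0 < c" "c < 1" by auto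
  have le: "r i \<le> c" if "i \<in> {1..l}" for i
    unfolding c_def using that by (intro Max_ge) auto
  have bound: "0 < word_ratio phi u \<and> word_ratio phi u \<le> c ^ length u" if "set u \<subseteq> {1..l}" for u
    using that
  proof (induction u)
    case Nil
    then show ?case by (simp add: word_ratio_def)
  next
    case (Cons i u)
    then have IH: "0 < word_ratio phi u" "word_ratio phi u \<le> c ^ length u" and i: "i \<in> {1..l}"
      by auto
    have "word_ratio phi (i # u) = r i * word_ratio phi u"
      by (simp add: word_ratio_def r_def)
    moreover have "r i * word_ratio phi u \<le> c * c ^ length u"
      using le[OF i] IH c by (intro mult_mono) auto
    ultimately show ?case using r[OF i] IH by simp
  qed
  obtain N where N: "c ^ N < (1/2) ^ n"
    using real_arch_pow_inv[of "(1/2) ^ n" c] c by auto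
  have "length u \<le> Suc N" if u: "u \<in> level_words l phi n" for u
  proof (rule ccontr)
    assume "\<not> length u \<le> Suc N"
    then have "N \<le> length (butlast u)" by simp
    then have "c ^ length (butlast u) \<le> c ^ N"
      using c by (intro power_decreasing) auto
    moreover have "set (butlast u) \<subseteq> {1..l}"
      using u by (auto simp: level_words_def dest: in_set_butlastD)
    ultimately have "word_ratio phi (butlast u) \<le> c ^ N"
      using bound by fastforce
    with N u show False by (simp add: level_words_def)
  qed
  then have "level_words l phi n \<subseteq> {u. set u \<subseteq> {1..l} \<and> length u \<le> Suc N}"
    by (auto simp: level_words_def)
  then show ?thesis
    by (rule finite_subset) (intro finite_lists_length_le, simp)
qed

end

theory Submission
  imports Defs "HOL-Real_Asymp.Real_Asymp"
begin

text \<open>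
  A word map has the form \<open>x \<mapsto> x / M + b\<close>, where \<open>M\<close> is a product of the \<open>m i\<close> and, \<open>D\<close> being a
  common denominator of the translations \<open>a i\<close>, the vector \<open>b\<close> lies in the lattice of mesh
  \<open>1 / (D * M)\<close>. For words of level \<open>n\<close> that mesh is comparable to \<open>2\<^sup>-\<^sup>n\<close>, so for each fixed \<open>M\<close> only
  boundedly many of the maps move the attractor close to a given point. The integer \<open>M\<close> depends only
  on how often each letter occurs in the word, and the length of the word is at most \<open>n\<close>, so there
  are at most \<open>(n + 1)\<^sup>l\<close> possible values of \<open>M\<close>. Thus the overlap count grows at most polynomially.
\<close>

section \<open>Existence and uniqueness of the attractor\<close>

text \<open>As there are finitely many maps, the largest ratio is a common Lipschitz constant
  \<open>c\<close> still below 1. Injectivity comes from the ratios being positive; it is what lets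
  preimages be followed through a nested intersection below.\<close>

lemma ifs_similarity_ratios:
  fixes phi :: "nat \<Rightarrow> real ^ 'd \<Rightarrow> real ^ 'd"
  assumes "ifs l phi"
  obtains c where "0 < c" "c < 1"
    "\<And>i x y. i \<in> {1..l} \<Longrightarrow> dist (phi i x) (phi i y) \<le> c * dist x y"
    "\<And>i. i \<in> {1..l} \<Longrightarrow> inj (phi i)"
proof -
  have "\<exists>r. \<forall>i\<in>{1..l}. 0 < r i \<and> r i < 1 \<and> (\<forall>x y. dist (phi i x) (phi i y) = r i * dist x y)"
    using assms unfolding ifs_def contracting_similarity_def similarity_with_ratio_def
    by (intro bchoice) blast
  then obtain r where r: "\<And>i. i \<in> {1..l} \<Longrightarrow> 0 < r i" "\<And>i. i \<in> {1..l} \<Longrightarrow> r i < 1"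
    "\<And>i x y. i \<in> {1..l} \<Longrightarrow> dist (phi i x) (phi i y) = r i * dist x y"
    by blast
  define c where "c = Max (r ` {1..l})"
  have "c \<in> r ` {1..l}" unfolding c_def using assms by (intro Max_in) (auto simp: ifs_def)
  then have c: "0 < c" "c < 1" using r by auto
  have le: "r i \<le> c" if "i \<in> {1..l}" for i
    unfolding c_def using that by (intro Max_ge) auto
  have "inj (phi i)" if "i \<in> {1..l}" for i
  proof (rule injI)
    fix x y assume "phi i x = phi i y"
    then have "r i * dist x y = 0" using r(3)[OF that, of x y] by simp
    then show "x = y" using r(1)[OF that] by simp
  qed
  then show ?thesis
    using that[OF c] r(3) le by (metis mult_right_mono zero_le_dist)
qed

lemma ifs_continuous_on:
  assumes "ifs l phi" "i \<in> {1..l}"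
  shows "continuous_on S (phi i)"
proof -
  obtain c where c: "0 < c" "\<And>x y. dist (phi i x) (phi i y) \<le> c * dist x y"
    using ifs_similarity_ratios[OF assms(1)] assms(2) by metis
  have "c-lipschitz_on S (phi i)"
    using c by (intro lipschitz_onI) auto
  then show ?thesis by (rule lipschitz_on_continuous_on)
qed

text \<open>The Hutchinson operator \<open>F\<close> maps a large closed ball into itself, so its
  iterates on that ball form a decreasing sequence of non-empty compact sets. Their intersection is
  the invariant set.\<close>

lemma invariant_compact_exists:
  assumes ifs: "ifs l phi"
  shows "\<exists>K. K \<noteq> {} \<and> compact K \<and> K = (\<Union>i\<in>{1..l}. phi i ` K)"
proof -
  obtain c where c: "0 < c" "c < 1"
    "\<And>i x y. i \<in> {1..l} \<Longrightarrow> dist (phi i x) (phi i y) \<le> c * dist x y"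
    and inj: "\<And>i. i \<in> {1..l} \<Longrightarrow> inj (phi i)"
    using ifs_similarity_ratios[OF ifs] by metis
  define A where "A = Max ((\<lambda>i. norm (phi i 0)) ` {1..l})"
  have A: "norm (phi i 0) \<le> A" if "i \<in> {1..l}" for i
    unfolding A_def using that by (intro Max_ge) auto
  have one: "1 \<in> {1..l}" using ifs by (auto simp: ifs_def)
  have A0: "0 \<le> A" using A[OF one] norm_ge_zero order_trans by blast
  \<comment> \<open>The radius is the fixed point of \<open>s \<mapsto> A + c * s\<close>, which
    bounds \<open>norm (phi i x)\<close> when \<open>norm x \<le> s\<close>. Hence
    \<open>F B \<subseteq> B\<close>.\<close>
  define B where "B = cball (0 :: real ^ 'a) (A / (1 - c))"
  define F where "F K = (\<Union>i\<in>{1..l}. phi i ` K)" for K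
  define G where "G n = (F ^^ n) B" for n
  have mono: "F S \<subseteq> F T" if "S \<subseteq> T" for S T using that by (auto simp: F_def)
  have FB: "F B \<subseteq> B"
  proof -
    have "norm (phi i x) \<le> A / (1 - c)" if i: "i \<in> {1..l}" and x: "norm x \<le> A / (1 - c)" for i x
    proof -
      have "norm (phi i x) \<le> norm (phi i 0) + dist (phi i x) (phi i 0)"
        unfolding dist_norm by norm
      also have "\<dots> \<le> A + c * norm x"
        using A[OF i] c(3)[OF i, of x 0] by simp
      also have "\<dots> \<le> A + c * (A / (1 - c))" using mult_left_mono[OF x, of c] c(1) by simp
      also have "\<dots> = A / (1 - c)" using c by (simp add: field_simps)
      finally show ?thesis .
    qed
    then show ?thesis by (auto simp: F_def B_def)
  qed
  have G_Suc: "G (Suc n) = F (G n)" for n by (simp add: G_def)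
  have dec1: "G (Suc n) \<subseteq> G n" for n
    by (induction n) (use FB mono G_Suc in \<open>auto simp: G_def\<close>)
  then have dec: "G n \<subseteq> G k" if "k \<le> n" for k n
    using that by (metis lift_Suc_antimono_le)
  have cG: "compact (G n)" for n
  proof (induction n)
    case 0
    then show ?case by (simp add: G_def B_def)
  next
    case (Suc n)
    then show ?case unfolding G_Suc F_def
      by (intro compact_UN compact_continuous_image ifs_continuous_on[OF ifs]) auto
  qed
  have neG: "G n \<noteq> {}" for n
  proof (induction n)
    case 0
    have "0 \<le> A / (1 - c)" using A0 c(2) by simp
    then show ?case by (simp add: G_def B_def)
  next
    case (Suc n)
    then show ?case unfolding G_Suc F_def using one by auto
  qed
  define K where "K = (\<Inter>n. G n)"
  have "K \<noteq> {}" unfolding K_def using compact_nest[of G] cG neG dec by blast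
  moreover have "compact K"
    unfolding K_def using cG by (intro compact_Inter) auto
  moreover have "K = F K"
  proof
    have "F K \<subseteq> G n" for n
    proof -
      have "F K \<subseteq> F (G n)" by (rule mono) (auto simp: K_def)
      then show ?thesis using dec1 G_Suc by blast
    qed
    then show "F K \<subseteq> K" unfolding K_def by blast
    show "K \<subseteq> F K"
    proof
      fix x assume x: "x \<in> K"
      have "\<exists>i\<in>{1..l}. x \<in> phi i ` G n" for n
      proof -
        have "x \<in> F (G n)" using x G_Suc unfolding K_def by blast
        then show ?thesis by (auto simp: F_def)
      qed
      then obtain i where i: "i n \<in> {1..l}" "x \<in> phi (i n) ` G n" for n
        unfolding Bex_def using choice[of "\<lambda>n i. i \<in> {1..l} \<and> x \<in> phi i ` G n"] by blast
      have "\<exists>k. infinite {n. i n = k}"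
      proof (rule ccontr)
        assume "\<nexists>k. infinite {n. i n = k}"
        then have "finite (\<Union>k\<in>{1..l}. {n. i n = k})" by auto
        moreover have "(\<Union>k\<in>{1..l}. {n. i n = k}) = UNIV" using i(1) by auto
        ultimately show False using infinite_UNIV_nat by metis
      qed
      then obtain k where k: "infinite {n. i n = k}" by blast
      then obtain n where "i n = k" by (auto dest: infinite_imp_nonempty)
      with i(1) have kl: "k \<in> {1..l}" by blast
      have all: "x \<in> phi k ` G n" for n
      proof -
        obtain N where "N \<ge> n" "i N = k"
          using k unfolding infinite_nat_iff_unbounded_le by blast
        then show ?thesis using i(2)[of N] dec[of n N] by auto
      qed
      then obtain y where y: "x = phi k y" by blast
      \<comment> \<open>Injectivity forces the preimages of \<open>x\<close> taken in the different
        \<open>G n\<close> to be the same point \<open>y\<close>.\<close>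
      have "y \<in> G n" for n using all[of n] inj[OF kl] y by (auto dest: injD)
      then have "y \<in> K" by (simp add: K_def)
      then show "x \<in> F K" using y kl unfolding F_def by blast
    qed
  qed
  ultimately show ?thesis unfolding F_def by blast
qed

text \<open>Consider a point of \<open>K\<close> farthest from \<open>L\<close>. It is the image of
  another point of \<open>K\<close>, and each map shrinks the distance to \<open>L\<close> by the
  factor \<open>c < 1\<close>; so the maximal distance is at most \<open>c\<close> times itself and
  vanishes. Exchanging \<open>K\<close> and \<open>L\<close> gives uniqueness.\<close>

lemma invariant_compact_subset:
  assumes ifs: "ifs l phi"
    and K: "compact K" "K = (\<Union>i\<in>{1..l}. phi i ` K)"
    and L: "L \<noteq> {}" "compact L" "L = (\<Union>i\<in>{1..l}. phi i ` L)"
  shows "K \<subseteq> L"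
proof (cases "K = {}")
  case False
  obtain c where c: "0 < c" "c < 1"
    "\<And>i x y. i \<in> {1..l} \<Longrightarrow> dist (phi i x) (phi i y) \<le> c * dist x y"
    using ifs_similarity_ratios[OF ifs] by metis
  have "continuous_on K (\<lambda>x. infdist x L)" by (intro continuous_intros)
  then obtain x where x: "x \<in> K" and max: "\<And>y. y \<in> K \<Longrightarrow> infdist y L \<le> infdist x L"
    using continuous_attains_sup[OF K(1) False] by blast
  obtain i y where i: "i \<in> {1..l}" and y: "y \<in> K" "x = phi i y"
    using x K(2) by blast
  obtain z where z: "z \<in> L" "infdist y L = dist y z"
    using infdist_attains_inf[OF compact_imp_closed[OF L(2)] L(1)] by blast
  have "phi i z \<in> L" using z i L(3) by blast
  then have "infdist x L \<le> dist (phi i y) (phi i z)" using y by (auto intro: infdist_le)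
  also have "\<dots> \<le> c * infdist y L" using c(3)[OF i] z by simp
  also have "\<dots> \<le> c * infdist x L" using max[OF y(1)] c by simp
  finally have "(1 - c) * infdist x L \<le> 0" by (simp add: algebra_simps)
  then have "infdist x L \<le> 0" using c by (simp add: mult_le_0_iff)
  then have "infdist w L = 0" if "w \<in> K" for w
    using max[OF that] infdist_nonneg[of w L] by simp
  then show ?thesis
    using in_closed_iff_infdist_zero[OF compact_imp_closed[OF L(2)] L(1)] by blast
qed simp

text \<open>The attractor is a definite description, so existence and uniqueness must both be
  established before any property of it can be read off. Its boundedness enters the
  counting.\<close>

lemma compact_attractor:
  assumes "ifs l phi"
  shows "compact (attractor l phi)"
proof -
  define P where "P K \<longleftrightarrow> K \<noteq> {} \<and> compact K \<and> K = (\<Union>i\<in>{1..l}. phi i ` K)" for K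
  have "K = L" if "P K" "P L" for K L
    using that invariant_compact_subset[OF assms] unfolding P_def by (metis subset_antisym)
  moreover have "\<exists>K. P K" unfolding P_def by (rule invariant_compact_exists[OF assms])
  ultimately have "P (The P)" by (metis theI)
  moreover have "attractor l phi = The P" by (simp add: attractor_def P_def[abs_def])
  ultimately show ?thesis by (simp add: P_def)
qed

section \<open>Counting\<close>

lemma common_denominator:
  fixes S :: "real set"
  assumes "finite S" "S \<subseteq> \<rat>"
  shows "\<exists>D::int. D > 0 \<and> (\<forall>q\<in>S. of_int D * q \<in> \<int>)"
  using assms
proof (induction S)
  case empty
  then show ?case by (intro exI[of _ 1]) auto
next
  case (insert q S)
  then obtain D :: int where D: "D > 0" "\<And>q. q \<in> S \<Longrightarrow> of_int D * q \<in> \<int>" by auto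
  obtain a b :: int where ab: "b > 0" "q = of_int a / of_int b"
    using insert.prems by (auto elim: Rats_cases')
  have "of_int (D * b) * q \<in> \<int>"
  proof -
    have "of_int (D * b) * q = of_int (D * a)" using ab by simp
    then show ?thesis by (metis Ints_of_int)
  qed
  moreover have "of_int (D * b) * p \<in> \<int>" if "p \<in> S" for p
    using Ints_mult[OF Ints_of_int[of b] D(2)[OF that]] by (simp add: ac_simps)
  ultimately show ?case using D ab by (intro exI[of _ "D * b"]) auto
qed

lemma card_integers_between_le:
  fixes y w :: real
  shows "card {\<lceil>y - w\<rceil>..\<lfloor>y + w\<rfloor>} \<le> nat \<lfloor>2 * w\<rfloor> + 1"
proof -
  have "\<lfloor>y + w\<rfloor> - \<lceil>y - w\<rceil> \<le> \<lfloor>2 * w\<rfloor>" by linarith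
  then show ?thesis by simp
qed

text \<open>Scaling by \<open>q\<close> turns the coordinates into integers confined to intervals of
  length \<open>2 * \<bar>q\<bar> * rho\<close>; \<open>floor\<close> only changes their type and
  loses nothing on \<open>S\<close>. The bound does not involve \<open>x\<close>, which makes the
  later count uniform in the centre of the ball.\<close>

lemma lattice_points_in_cube:
  fixes x :: "real ^ 'd" and q rho :: real
  assumes "q \<noteq> 0"
  defines "S \<equiv> {b :: real ^ 'd. \<forall>j. q * b $ j \<in> \<int> \<and> \<bar>b $ j - x $ j\<bar> \<le> rho}"
  shows "finite S" and "card S \<le> (nat \<lfloor>2 * (\<bar>q\<bar> * rho)\<rfloor> + 1) ^ CARD('d)"
proof -
  define w where "w = \<bar>q\<bar> * rho"
  define P where "P = (PiE UNIV (\<lambda>j::'d. {\<lceil>q * x $ j - w\<rceil>..\<lfloor>q * x $ j + w\<rfloor>}))"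
  have finP: "finite P" unfolding P_def by (intro finite_PiE) auto
  have sub: "(\<lambda>b j. \<lfloor>q * b $ j\<rfloor>) ` S \<subseteq> P"
  proof -
    have "\<lceil>q * x $ j - w\<rceil> \<le> \<lfloor>q * b $ j\<rfloor> \<and> \<lfloor>q * b $ j\<rfloor> \<le> \<lfloor>q * x $ j + w\<rfloor>" if b: "b \<in> S" for b j
    proof -
      have "\<bar>q * b $ j - q * x $ j\<bar> \<le> w"
        using b unfolding S_def w_def
        by (simp add: abs_mult mult_left_mono flip: right_diff_distrib)
      moreover obtain k where "q * b $ j = of_int k"
        using b unfolding S_def by (auto elim: Ints_cases)
      ultimately show ?thesis by (simp add: le_floor_iff ceiling_le_iff abs_le_iff)
    qed
    then show ?thesis by (auto simp: P_def)
  qed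
  have inj: "inj_on (\<lambda>b j. \<lfloor>q * b $ j\<rfloor>) S"
  proof (rule inj_onI)
    fix b b' assume b: "b \<in> S" "b' \<in> S" and eq: "(\<lambda>j. \<lfloor>q * b $ j\<rfloor>) = (\<lambda>j. \<lfloor>q * b' $ j\<rfloor>)"
    have "q * b $ j = q * b' $ j" for j
      using b fun_cong[OF eq, of j] unfolding S_def
      by (metis (mono_tags, lifting) Ints_cases floor_of_int mem_Collect_eq)
    then show "b = b'" using assms by (simp add: vec_eq_iff)
  qed
  show "finite S" using finite_imageD[OF finite_subset[OF sub finP] inj] .
  have "card S \<le> card P" by (rule card_inj_on_le[OF inj sub finP])
  also have "\<dots> = (\<Prod>j::'d\<in>UNIV. card {\<lceil>q * x $ j - w\<rceil>..\<lfloor>q * x $ j + w\<rfloor>})"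
    unfolding P_def by (intro card_PiE) auto
  also have "\<dots> \<le> (\<Prod>j::'d\<in>UNIV. nat \<lfloor>2 * w\<rfloor> + 1)"
    by (intro prod_mono conjI card_integers_between_le) auto
  finally show "card S \<le> (nat \<lfloor>2 * (\<bar>q\<bar> * rho)\<rfloor> + 1) ^ CARD('d)" by (simp add: w_def)
qed

text \<open>By commutativity the order of the letters is irrelevant. This is what reduces
  exponentially many words to polynomially many multipliers.\<close>

lemma prod_list_map_eq_prod_count:
  fixes m :: "'a \<Rightarrow> 'b :: comm_monoid_mult"
  assumes "set u \<subseteq> A" "finite A"
  shows "prod_list (map m u) = (\<Prod>i\<in>A. m i ^ count_list u i)"
  using assms
proof (induction u)
  case (Cons k u)
  have "(\<Prod>i\<in>A. m i ^ count_list (k # u) i)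
      = (\<Prod>i\<in>A. (if k = i then m i else 1) * m i ^ count_list u i)"
    by (intro prod.cong) auto
  also have "\<dots> = m k * (\<Prod>i\<in>A. m i ^ count_list u i)"
    using Cons.prems by (simp add: prod.distrib prod.delta)
  finally show ?case using Cons by simp
qed simp

lemma products_of_bounded_length:
  fixes m :: "'a \<Rightarrow> 'b :: comm_monoid_mult" and n :: nat
  assumes "finite A"
  defines "S \<equiv> {prod_list (map m u) | u. set u \<subseteq> A \<and> length u \<le> n}"
  shows "finite S" and "card S \<le> (n + 1) ^ card A"
proof -
  define P where "P = (PiE A (\<lambda>_. {0..n}))"
  have finP: "finite P" unfolding P_def using assms by (intro finite_PiE) auto
  have sub: "S \<subseteq> (\<lambda>k. \<Prod>i\<in>A. m i ^ k i) ` P"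
  proof
    fix s assume "s \<in> S"
    then obtain u where u: "s = prod_list (map m u)" "set u \<subseteq> A" "length u \<le> n"
      by (auto simp: S_def)
    \<comment> \<open>The exponent vector is restricted to \<open>A\<close> because elements of
      \<open>PiE\<close> must be \<open>undefined\<close> outside it.\<close>
    have "s = (\<Prod>i\<in>A. m i ^ restrict (count_list u) A i)"
      using prod_list_map_eq_prod_count[OF u(2) assms(1)] u(1) by simp
    moreover have "restrict (count_list u) A \<in> P"
      using order_trans[OF count_le_length u(3)] by (auto simp: P_def)
    ultimately show "s \<in> (\<lambda>k. \<Prod>i\<in>A. m i ^ k i) ` P" by blast
  qed
  show "finite S" using finite_subset[OF sub] finP by blast
  have "card S \<le> card P" by (rule surj_card_le[OF finP sub])
  also have "\<dots> = (n + 1) ^ card A" unfolding P_def using assms by (simp add: card_PiE)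
  finally show "card S \<le> (n + 1) ^ card A" .
qed

section \<open>Integer homotheties with rational translations\<close>

text \<open>Prepending \<open>i\<close> replaces \<open>b\<close> by \<open>b / m i + a i\<close>.
  Multiplied by \<open>D * m i * M u\<close>, the first term becomes \<open>D * M u * b\<close> and
  the second an integer multiple of \<open>D * a i\<close>, so both stay integral. Thus
  \<open>D\<close> enters the denominator only once, whatever the length of the word.\<close>

lemma word_map_homothety:
  fixes phi :: "nat \<Rightarrow> real ^ 'd \<Rightarrow> real ^ 'd" and m :: "nat \<Rightarrow> int" and D :: int
  assumes "\<And>i x. i \<in> A \<Longrightarrow> phi i x = (1 / real_of_int (m i)) *\<^sub>R x + a i"
    and "\<And>i. i \<in> A \<Longrightarrow> m i \<noteq> 0"
    and "\<And>i j. i \<in> A \<Longrightarrow> of_int D * a i $ j \<in> \<int>"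
    and "set u \<subseteq> A"
  defines "M \<equiv> \<lambda>u. real_of_int (prod_list (map m u))"
  shows "\<exists>b. word_map phi u = (\<lambda>x. (1 / M u) *\<^sub>R x + b) \<and> (\<forall>j. of_int D * M u * b $ j \<in> \<int>)"
  using assms(4)
proof (induction u)
  case Nil
  then show ?case by (intro exI[of _ 0]) (auto simp: word_map_def M_def)
next
  case (Cons i u)
  then obtain b where b: "word_map phi u = (\<lambda>x. (1 / M u) *\<^sub>R x + b)"
    "\<And>j. of_int D * M u * b $ j \<in> \<int>" by auto
  have i: "i \<in> A" using Cons.prems by simp
  have M: "M (i # u) = of_int (m i) * M u" by (simp add: M_def)
  define b' where "b' = (1 / real_of_int (m i)) *\<^sub>R b + a i"
  have "word_map phi (i # u) = (\<lambda>x. phi i (word_map phi u x))"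
    by (auto simp: word_map_def)
  also have "\<dots> = (\<lambda>x. (1 / M (i # u)) *\<^sub>R x + b')"
    using assms(1)[OF i] by (simp add: b M b'_def scaleR_add_right add.assoc)
  finally have "word_map phi (i # u) = (\<lambda>x. (1 / M (i # u)) *\<^sub>R x + b')" .
  moreover have "of_int D * M (i # u) * b' $ j \<in> \<int>" for j
  proof -
    have "of_int D * M (i # u) * b' $ j
        = of_int D * M u * b $ j + of_int (m i) * M u * (of_int D * a i $ j)"
      using assms(2)[OF i] by (simp add: M b'_def field_simps)
    also have "\<dots> \<in> \<int>"
      by (intro Ints_add b(2) Ints_mult[OF _ assms(3)[OF i]]) (simp add: M_def)
    finally show ?thesis .
  qed
  ultimately show ?case by blast
qed

lemma word_ratio_homothety:
  fixes phi :: "nat \<Rightarrow> real ^ 'd \<Rightarrow> real ^ 'd" and m :: "nat \<Rightarrow> int"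
  assumes "\<And>i x. i \<in> A \<Longrightarrow> phi i x = (1 / real_of_int (m i)) *\<^sub>R x + a i"
    and "set u \<subseteq> A"
  shows "word_ratio phi u = 1 / \<bar>real_of_int (prod_list (map m u))\<bar>"
  using assms(2)
proof (induction u)
  case (Cons i u)
  then have "phi i = (\<lambda>x. (1 / real_of_int (m i)) *\<^sub>R x + a i)"
    using assms(1) by auto
  then show ?case
    using Cons contraction_ratio_homothety[of "real_of_int (m i)" "a i"]
    by (simp add: word_ratio_def abs_mult)
qed (simp add: word_ratio_def)

section \<open>Level words and the maps near a point\<close>

lemma two_power_length_le_abs_prod_list:
  fixes m :: "'a \<Rightarrow> int"
  assumes "\<And>i. i \<in> set u \<Longrightarrow> \<bar>m i\<bar> > 1"
  shows "2 ^ length u \<le> \<bar>prod_list (map m u)\<bar>"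
  using assms
proof (induction u)
  case (Cons i u)
  have "2 * 2 ^ length u \<le> \<bar>m i\<bar> * \<bar>prod_list (map m u)\<bar>"
    using Cons.prems[of i] Cons.IH[OF Cons.prems] by (intro mult_mono) auto
  then show ?case by (simp add: abs_mult)
qed simp

text \<open>Write \<open>u = v @ [i]\<close>. The stopping rule says that the multiplier of
  \<open>u\<close> has reached \<open>2 ^ n\<close> while that of \<open>v\<close> has not, and the
  last letter contributes a factor of at most \<open>B\<close>.\<close>

lemma level_word_bounds:
  fixes phi :: "nat \<Rightarrow> real ^ 'd \<Rightarrow> real ^ 'd" and m :: "nat \<Rightarrow> int"
  assumes phi: "\<And>i x. i \<in> {1..l} \<Longrightarrow> phi i x = (1 / real_of_int (m i)) *\<^sub>R x + a i"
    and m: "\<And>i. i \<in> {1..l} \<Longrightarrow> \<bar>m i\<bar> > 1" "\<And>i. i \<in> {1..l} \<Longrightarrow> \<bar>m i\<bar> \<le> B"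
    and u: "u \<in> level_words l phi n"
  defines "M \<equiv> real_of_int (prod_list (map m u))"
  shows "length u \<le> n" and "2 ^ n \<le> \<bar>M\<bar>" and "\<bar>M\<bar> \<le> of_int B * 2 ^ n"
proof -
  have "u \<noteq> []" using u by (simp add: level_words_def)
  then obtain v i where vi: "u = v @ [i]" by (metis rev_exhaust)
  have sub: "set v \<subseteq> {1..l}" "i \<in> {1..l}" "set u \<subseteq> {1..l}"
    using u vi by (auto simp: level_words_def)
  define N where "N = prod_list (map m v)"
  have MN: "\<bar>M\<bar> = \<bar>of_int N\<bar> * \<bar>of_int (m i)\<bar>" by (simp add: M_def N_def vi abs_mult)
  have N2: "2 ^ length v \<le> \<bar>N\<bar>"
    unfolding N_def using sub(1) m(1) by (intro two_power_length_le_abs_prod_list) auto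
  have "(2::int) ^ length u \<le> \<bar>prod_list (map m u)\<bar>"
    using sub(3) m(1) by (intro two_power_length_le_abs_prod_list) auto
  then have "\<bar>prod_list (map m u)\<bar> > 0" by (rule less_le_trans[rotated]) simp
  then have Mpos: "\<bar>M\<bar> > 0" unfolding M_def by simp
  have Npos: "\<bar>N\<bar> > 0" by (rule less_le_trans[OF _ N2]) simp
  have 1: "1 / \<bar>M\<bar> \<le> (1/2) ^ n" and 2: "(1/2) ^ n < 1 / \<bar>real_of_int N\<bar>"
    using u word_ratio_homothety[of "{1..l}" phi m a, OF phi] sub
    by (auto simp: level_words_def vi M_def N_def)
  from 1 Mpos show "2 ^ n \<le> \<bar>M\<bar>" by (simp add: field_simps power_one_over)
  from 2 Npos have N3: "\<bar>real_of_int N\<bar> < 2 ^ n" by (simp add: field_simps power_one_over)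
  then have N4: "\<bar>N\<bar> < 2 ^ n" by (metis of_int_abs of_int_less_numeral_power_cancel_iff)
  \<comment> \<open>The strict inequality gives \<open>length v < n\<close>, which leaves room for
    the last letter: \<open>length u \<le> n\<close>.\<close>
  with N2 have "(2::int) ^ length v < 2 ^ n" by linarith
  then show "length u \<le> n" using vi by simp
  have "\<bar>of_int N\<bar> * \<bar>real_of_int (m i)\<bar> \<le> 2 ^ n * of_int B"
    using N3 m(2)[OF sub(2)] by (intro mult_mono) (simp_all flip: of_int_abs)
  then show "\<bar>M\<bar> \<le> of_int B * 2 ^ n" by (simp add: MN mult.commute)
qed

text \<open>The translation \<open>b\<close> is the image of the origin, and the image of any
  \<open>y\<close> in \<open>K\<close> differs from it by \<open>y / M\<close>, of norm at most
  \<open>R * e\<close>. An image point within \<open>e\<close> of \<open>x\<close> therefore keeps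
  \<open>b\<close> within \<open>(1 + R) * e\<close>.\<close>

lemma homothety_meets_ball:
  fixes K :: "(real ^ 'd) set"
  assumes "(\<lambda>y. (1 / M) *\<^sub>R y + b) ` K \<inter> cball x e \<noteq> {}"
    and "\<And>y. y \<in> K \<Longrightarrow> norm y \<le> R" and "0 < e" "1 / e \<le> \<bar>M\<bar>"
  shows "\<bar>b $ j - x $ j\<bar> \<le> (1 + R) * e"
proof -
  obtain y where y: "y \<in> K" "dist x ((1 / M) *\<^sub>R y + b) \<le> e"
    using assms(1) by auto
  have R: "0 \<le> R" using assms(2)[OF y(1)] norm_ge_zero order_trans by blast
  have "0 < \<bar>M\<bar>" by (rule less_le_trans[OF _ assms(4)]) (use assms(3) in simp)
  then have "1 / \<bar>M\<bar> \<le> e" using assms(3,4) by (simp add: field_simps)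
  then have "(1 / \<bar>M\<bar>) * norm y \<le> e * R"
    using assms(2)[OF y(1)] assms(3) by (intro mult_mono) auto
  then have *: "norm ((1 / M) *\<^sub>R y) \<le> e * R" by simp
  have "\<bar>b $ j - x $ j\<bar> \<le> norm (b - x)"
    using component_le_norm_cart[of "b - x" j] by simp
  also have "\<dots> \<le> dist x ((1 / M) *\<^sub>R y + b) + norm ((1 / M) *\<^sub>R y)"
    using norm_triangle_ineq4[of "(1 / M) *\<^sub>R y + b - x" "(1 / M) *\<^sub>R y"]
    by (simp add: dist_norm norm_minus_commute algebra_simps)
  also have "\<dots> \<le> (1 + R) * e" using y(2) * by (simp add: algebra_simps)
  finally show ?thesis .
qed

text \<open>The maps are sorted by their multiplier \<open>M\<close>: there are at most
  \<open>(n + 1) ^ l\<close> multipliers, and each admits at most \<open>P\<close> translations,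
  with \<open>P\<close> independent of \<open>n\<close> and \<open>x\<close>.\<close>

lemma card_maps_near_polynomial:
  fixes phi :: "nat \<Rightarrow> real ^ 'd \<Rightarrow> real ^ 'd" and m :: "nat \<Rightarrow> int"
  assumes ifs: "ifs l phi"
    and phi: "\<And>i x. i \<in> {1..l} \<Longrightarrow> phi i x = (1 / real_of_int (m i)) *\<^sub>R x + a i"
    and m: "\<And>i. i \<in> {1..l} \<Longrightarrow> \<bar>m i\<bar> > 1"
    and a: "\<And>i j. i \<in> {1..l} \<Longrightarrow> a i $ j \<in> \<rat>"
  shows "\<exists>C>0. \<forall>n x. card (maps_near l phi n x) \<le> C * (n + 1) ^ l"
proof -
  obtain D :: int where D: "D > 0" "\<And>i j. i \<in> {1..l} \<Longrightarrow> of_int D * a i $ j \<in> \<int>"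
  proof -
    have "\<exists>D::int. D > 0 \<and> (\<forall>q\<in>(\<lambda>(i, j). a i $ j) ` ({1..l} \<times> UNIV). of_int D * q \<in> \<int>)"
      using a by (intro common_denominator) auto
    then show ?thesis using that by fastforce
  qed
  obtain R where R: "R > 0" "\<And>y. y \<in> attractor l phi \<Longrightarrow> norm y \<le> R"
    using compact_imp_bounded[OF compact_attractor[OF ifs]] bounded_pos by metis
  define B where "B = Max ((\<lambda>i. \<bar>m i\<bar>) ` {1..l})"
  have B: "\<bar>m i\<bar> \<le> B" if "i \<in> {1..l}" for i
    unfolding B_def using that by (intro Max_ge) auto
  \<comment> \<open>This bounds \<open>\<bar>D * M\<bar> * rho\<close>: the factor
    \<open>2 ^ n\<close> bounding \<open>M\<close> cancels the \<open>(1/2) ^ n\<close> in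
    \<open>rho\<close>, so \<open>w\<close> is free of \<open>n\<close>.\<close>
  define w where "w = of_int D * of_int B * (1 + R)"
  define P where "P = (nat \<lfloor>2 * w\<rfloor> + 1) ^ CARD('d)"
  have "card (maps_near l phi n x) \<le> P * (n + 1) ^ l" for n x
  proof -
    define Ms where "Ms = {prod_list (map m u) | u. set u \<subseteq> {1..l} \<and> length u \<le> n}"
    \<comment> \<open>The lower bound makes \<open>M\<close> non-zero and the images of the
      attractor small; the upper bound keeps the lattice of translations from being too
      fine.\<close>
    define Ns where "Ns = {M \<in> Ms. 2 ^ n \<le> \<bar>real_of_int M\<bar> \<and> \<bar>real_of_int M\<bar> \<le> of_int B * 2 ^ n}"
    define rho where "rho = (1 + R) * (1/2) ^ n"
    define T where "T M = {b :: real ^ 'd. \<forall>j. (of_int D * of_int M) * b $ j \<in> \<int>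
      \<and> \<bar>b $ j - x $ j\<bar> \<le> rho}" for M :: int
    define H where "H M b = (\<lambda>y :: real ^ 'd. (1 / real_of_int M) *\<^sub>R y + b)" for M :: int and b
    have finM: "finite Ns" "card Ns \<le> (n + 1) ^ l"
    proof -
      have Ms: "finite Ms" "card Ms \<le> (n + 1) ^ l"
        using products_of_bounded_length[of "{1..l}" m n] by (simp_all add: Ms_def)
      then show "finite Ns" by (simp add: Ns_def)
      have "card Ns \<le> card Ms" using Ms(1) by (intro card_mono) (auto simp: Ns_def)
      with Ms(2) show "card Ns \<le> (n + 1) ^ l" by simp
    qed
    have T: "finite (T M)" "card (T M) \<le> P" if M: "M \<in> Ns" for M
    proof -
      have pos: "0 < \<bar>real_of_int M\<bar>"
        by (rule less_le_trans[of 0 "2 ^ n"]) (use M in \<open>simp_all add: Ns_def\<close>)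
      then have q: "real_of_int D * of_int M \<noteq> 0" using D(1) by auto
      show "finite (T M)" unfolding T_def by (rule lattice_points_in_cube(1)[OF q])
      have "\<bar>of_int D * of_int M\<bar> * rho \<le> (of_int D * (of_int B * 2 ^ n)) * rho"
        unfolding abs_mult using M D(1) R(1)
        by (intro mult_right_mono mult_mono) (auto simp: Ns_def rho_def)
      also have "\<dots> = w" by (simp add: w_def rho_def power_one_over)
      finally have "nat \<lfloor>2 * (\<bar>of_int D * of_int M\<bar> * rho)\<rfloor> \<le> nat \<lfloor>2 * w\<rfloor>"
        by (intro nat_mono floor_mono) simp
      then have "(nat \<lfloor>2 * (\<bar>of_int D * of_int M\<bar> * rho)\<rfloor> + 1) ^ CARD('d) \<le> P"
        unfolding P_def by (intro power_mono) auto
      with lattice_points_in_cube(2)[OF q, of x rho] show "card (T M) \<le> P"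
        unfolding T_def by linarith
    qed
    \<comment> \<open>The cover is indexed by pairs \<open>(M, b)\<close> and not by words, so words
      with the same map are counted together.\<close>
    have sub: "maps_near l phi n x \<subseteq> (\<Union>M\<in>Ns. H M ` T M)"
    proof
      fix f assume "f \<in> maps_near l phi n x"
      then obtain u where u: "f = word_map phi u" "u \<in> level_words l phi n"
        "f ` attractor l phi \<inter> cball x ((1/2) ^ n) \<noteq> {}"
        by (auto simp: maps_near_def)
      define M where "M = prod_list (map m u)"
      have set: "set u \<subseteq> {1..l}" using u by (simp add: level_words_def)
      note bounds = level_word_bounds[of l phi m a B u n, OF phi m B u(2)]
      have M: "M \<in> Ns"
        using set bounds unfolding Ns_def Ms_def M_def by blast
      have m0: "m i \<noteq> 0" if "i \<in> {1..l}" for i using m[OF that] by auto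
      obtain b where b: "f = H M b" "\<And>j. of_int D * of_int M * b $ j \<in> \<int>"
        using word_map_homothety[of "{1..l}" phi m a D u, OF phi m0 D(2) set] u(1)
        unfolding M_def H_def by blast
      have "\<bar>b $ j - x $ j\<bar> \<le> rho" for j
        unfolding rho_def
      proof (rule homothety_meets_ball)
        show "(\<lambda>y. (1 / real_of_int M) *\<^sub>R y + b) ` attractor l phi \<inter> cball x ((1/2) ^ n) \<noteq> {}"
          using u(3) b(1) unfolding H_def by simp
      qed (use R M in \<open>auto simp: Ns_def power_one_over\<close>)
      then have "b \<in> T M" using b(2) by (simp add: T_def)
      then show "f \<in> (\<Union>M\<in>Ns. H M ` T M)" using M b(1) by blast
    qed
    have "card (maps_near l phi n x) \<le> card (\<Union>M\<in>Ns. H M ` T M)"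
      using sub finM(1) T(1) by (intro card_mono) auto
    also have "\<dots> \<le> (\<Sum>M\<in>Ns. card (H M ` T M))" by (rule card_UN_le[OF finM(1)])
    also have "\<dots> \<le> (\<Sum>M\<in>Ns. P)"
      using T card_image_le order_trans by (intro sum_mono) blast
    also have "\<dots> \<le> P * (n + 1) ^ l" using finM(2) by simp
    finally show ?thesis .
  qed
  moreover have "P > 0" by (simp add: P_def)
  ultimately show ?thesis by blast
qed

section \<open>From polynomial growth to the limit\<close>

lemma ln_over_n_tendsto_0:
  fixes t :: "nat \<Rightarrow> nat"
  assumes "C > 0" "\<And>n. t n \<le> C * (n + 1) ^ l"
  shows "(\<lambda>n. ln (real (t n)) / real n) \<longlonglongrightarrow> 0"
proof (rule real_tendsto_sandwich)
  have upper: "ln (real (t n)) \<le> ln (real C) + real l * ln (real n + 1)" for n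
  \<comment> \<open>Since \<open>ln 0 = 0\<close>, a vanishing count is covered too: the right-hand
    side is non-negative because \<open>C \<ge> 1\<close>.\<close>
  proof (cases "t n = 0")
    case False
    have "real (t n) \<le> real C * (real n + 1) ^ l"
      using assms(2)[of n] by (metis of_nat_1 of_nat_add of_nat_le_iff of_nat_mult of_nat_power)
    then have "ln (real (t n)) \<le> ln (real C * (real n + 1) ^ l)" using False by simp
    also have "\<dots> = ln (real C) + real l * ln (real n + 1)"
      using assms(1) by (simp add: ln_mult ln_realpow)
    finally show ?thesis .
  qed (use assms(1) in simp)
  show "\<forall>\<^sub>F n in sequentially. ln (real (t n)) / real n
      \<le> ln (real C) / real n + real l * (ln (real n + 1) / real n)"
    using upper by (intro always_eventually) (simp add: divide_right_mono flip: add_divide_distrib)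
  have "0 \<le> ln (real (t n))" for n by (cases "t n = 0") auto
  then show "\<forall>\<^sub>F n in sequentially. 0 \<le> ln (real (t n)) / real n" by simp
  have "(\<lambda>n. ln (real n + 1) / real n) \<longlonglongrightarrow> 0" by real_asymp
  then show "(\<lambda>n. ln (real C) / real n + real l * (ln (real n + 1) / real n)) \<longlonglongrightarrow> 0"
    by (intro tendsto_add_zero tendsto_mult_right_zero lim_const_over_n)
qed simp

theorem theorem1p4:
  fixes l :: nat
    and phi :: "nat \<Rightarrow> real ^ 'd \<Rightarrow> real ^ 'd"
    and m :: "nat \<Rightarrow> int"
    and a :: "nat \<Rightarrow> real ^ 'd"
  assumes "ifs l phi"
    and "\<And>i x. i \<in> {1..l} \<Longrightarrow> phi i x = (1 / real_of_int (m i)) *\<^sub>R x + a i"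
    and "\<And>i. i \<in> {1..l} \<Longrightarrow> \<bar>m i\<bar> > 1"
    and "\<And>i j. i \<in> {1..l} \<Longrightarrow> a i $ j \<in> \<rat>"
  shows "awsc l phi"
proof -
  obtain C where C: "C > 0" "\<And>n x. card (maps_near l phi n x) \<le> C * (n + 1) ^ l"
    using card_maps_near_polynomial[OF assms] by blast
  \<comment> \<open>As \<open>C\<close> does not depend on \<open>x\<close>, the bound passes to the
    supremum over all centres.\<close>
  have "overlap_count l phi n \<le> C * (n + 1) ^ l" for n
    unfolding overlap_count_def using C(2) by (intro cSUP_least) auto
  with C(1) show ?thesis unfolding awsc_def by (rule ln_over_n_tendsto_0)
qed

end
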